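(* Let $k$ be a field and $\lambda\in k$. Every countably generated associative $\lambda$-differential algebra over $k$ can be embedded into a two-generated associative $\lambda$-differential algebra over $k$; that is, for every such countably generated $A$ there exist an associative $\lambda$-differential algebra $H$ over $k$ generated as a $\lambda$-differential algebra by two elements and an injective homomorphism of $\lambda$-differential algebras $A\to H$.
   Context: For $\lambda\in k$, an associative $\lambda$-differential algebra over $k$ is an associative $k$-algebra $R$ (not required to have a unit) together with a $k$-linear operator $D:R\to R$ such that $D(xy)=D(x)y+xD(y)+\lambda D(x)D(y)$ for all $x,y\in R$. Homomorphisms are $k$-algebra homomorphisms (not required to preserve units) commuting with $D$. Such an algebra is generated by a subset $Y$ if the smallest $k$-subalgebra (not necessarily unital) containing $Y$ and closed under $D$ is the whole algebra; it is countably generated if generated by an at most countable set. *)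

theory Defs
  imports "HOL-Algebra.Algebra" "HOL-Library.Countable_Set"
begin

text \<open>
  The library locale \<open>algebra\<close> is commutative and unital, so associative, not necessarily unital
  algebras are built on top of \<open>module\<close>. The record field \<open>one\<close>, which every record extending
  \<open>ring\<close> carries, is left unconstrained and unused here.
\<close>

locale assoc_algebra = field K + module K A
  for K :: "('k, 'r) ring_scheme" (structure) and A :: "('k, 'a, 'm) module_scheme" (structure) +
  assumes mult_closed:
      "\<lbrakk>x \<in> carrier A; y \<in> carrier A\<rbrakk> \<Longrightarrow> x \<otimes>\<^bsub>A\<^esub> y \<in> carrier A"
    and mult_assoc:
      "\<lbrakk>x \<in> carrier A; y \<in> carrier A; z \<in> carrier A\<rbrakk> \<Longrightarrow>
        (x \<otimes>\<^bsub>A\<^esub> y) \<otimes>\<^bsub>A\<^esub> z = x \<otimes>\<^bsub>A\<^esub> (y \<otimes>\<^bsub>A\<^esub> z)"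
    and mult_add_left:
      "\<lbrakk>x \<in> carrier A; y \<in> carrier A; z \<in> carrier A\<rbrakk> \<Longrightarrow>
        (x \<oplus>\<^bsub>A\<^esub> y) \<otimes>\<^bsub>A\<^esub> z = x \<otimes>\<^bsub>A\<^esub> z \<oplus>\<^bsub>A\<^esub> y \<otimes>\<^bsub>A\<^esub> z"
    and mult_add_right:
      "\<lbrakk>x \<in> carrier A; y \<in> carrier A; z \<in> carrier A\<rbrakk> \<Longrightarrow>
        x \<otimes>\<^bsub>A\<^esub> (y \<oplus>\<^bsub>A\<^esub> z) = x \<otimes>\<^bsub>A\<^esub> y \<oplus>\<^bsub>A\<^esub> x \<otimes>\<^bsub>A\<^esub> z"
    and mult_smult_left:
      "\<lbrakk>c \<in> carrier K; x \<in> carrier A; y \<in> carrier A\<rbrakk> \<Longrightarrow>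
        (c \<odot>\<^bsub>A\<^esub> x) \<otimes>\<^bsub>A\<^esub> y = c \<odot>\<^bsub>A\<^esub> (x \<otimes>\<^bsub>A\<^esub> y)"
    and mult_smult_right:
      "\<lbrakk>c \<in> carrier K; x \<in> carrier A; y \<in> carrier A\<rbrakk> \<Longrightarrow>
        x \<otimes>\<^bsub>A\<^esub> (c \<odot>\<^bsub>A\<^esub> y) = c \<odot>\<^bsub>A\<^esub> (x \<otimes>\<^bsub>A\<^esub> y)"

record ('k, 'a) diff_algebra = "('k, 'a) module" +
  dop :: "'a \<Rightarrow> 'a"

locale lambda_diff_algebra = assoc_algebra K A
  for K :: "('k, 'r) ring_scheme" (structure) and lam :: 'k
    and A :: "('k, 'a, 'm) diff_algebra_scheme" (structure) +
  assumes lam_closed: "lam \<in> carrier K"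
    and dop_closed: "x \<in> carrier A \<Longrightarrow> dop A x \<in> carrier A"
    and dop_add:
      "\<lbrakk>x \<in> carrier A; y \<in> carrier A\<rbrakk> \<Longrightarrow> dop A (x \<oplus>\<^bsub>A\<^esub> y) = dop A x \<oplus>\<^bsub>A\<^esub> dop A y"
    and dop_smult:
      "\<lbrakk>c \<in> carrier K; x \<in> carrier A\<rbrakk> \<Longrightarrow> dop A (c \<odot>\<^bsub>A\<^esub> x) = c \<odot>\<^bsub>A\<^esub> dop A x"
    and dop_mult:
      "\<lbrakk>x \<in> carrier A; y \<in> carrier A\<rbrakk> \<Longrightarrow>
        dop A (x \<otimes>\<^bsub>A\<^esub> y) =
          dop A x \<otimes>\<^bsub>A\<^esub> y \<oplus>\<^bsub>A\<^esub> x \<otimes>\<^bsub>A\<^esub> dop A y \<oplus>\<^bsub>A\<^esub> lam \<odot>\<^bsub>A\<^esub> (dop A x \<otimes>\<^bsub>A\<^esub> dop A y)"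

definition diff_subalgebra ::
    "('k, 'r) ring_scheme \<Rightarrow> ('k, 'a, 'm) diff_algebra_scheme \<Rightarrow> 'a set \<Rightarrow> bool" where
  "diff_subalgebra K A S \<longleftrightarrow>
     submodule S K A \<and>
     (\<forall>x\<in>S. \<forall>y\<in>S. x \<otimes>\<^bsub>A\<^esub> y \<in> S) \<and>
     (\<forall>x\<in>S. dop A x \<in> S)"

definition generates ::
    "('k, 'r) ring_scheme \<Rightarrow> ('k, 'a, 'm) diff_algebra_scheme \<Rightarrow> 'a set \<Rightarrow> bool" where
  "generates K A Y \<longleftrightarrow>
     Y \<subseteq> carrier A \<and> \<Inter>{S. diff_subalgebra K A S \<and> Y \<subseteq> S} = carrier A"

definition countably_generated ::
    "('k, 'r) ring_scheme \<Rightarrow> ('k, 'a, 'm) diff_algebra_scheme \<Rightarrow> bool" where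
  "countably_generated K A \<longleftrightarrow> (\<exists>Y. countable Y \<and> generates K A Y)"

definition two_generated ::
    "('k, 'r) ring_scheme \<Rightarrow> ('k, 'a, 'm) diff_algebra_scheme \<Rightarrow> bool" where
  "two_generated K A \<longleftrightarrow> (\<exists>x y. generates K A {x, y})"

definition diff_hom ::
    "('k, 'r) ring_scheme \<Rightarrow> ('k, 'a, 'm) diff_algebra_scheme \<Rightarrow>
     ('k, 'b, 'n) diff_algebra_scheme \<Rightarrow> ('a \<Rightarrow> 'b) set" where
  "diff_hom K A B =
     {f. f \<in> carrier A \<rightarrow> carrier B \<and>
       (\<forall>x\<in>carrier A. \<forall>y\<in>carrier A. f (x \<oplus>\<^bsub>A\<^esub> y) = f x \<oplus>\<^bsub>B\<^esub> f y) \<and>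
       (\<forall>x\<in>carrier A. \<forall>y\<in>carrier A. f (x \<otimes>\<^bsub>A\<^esub> y) = f x \<otimes>\<^bsub>B\<^esub> f y) \<and>
       (\<forall>c\<in>carrier K. \<forall>x\<in>carrier A. f (c \<odot>\<^bsub>A\<^esub> x) = c \<odot>\<^bsub>B\<^esub> f x) \<and>
       (\<forall>x\<in>carrier A. f (dop A x) = dop B (f x))}"

text \<open>
  HOL cannot quantify existentially over types, so an existentially quantified two-generated
  algebra has to live on a fixed type. A two-generated algebra over a field \<open>K\<close> has cardinality
  at most \<open>max |K| \<aleph>\<^sub>0\<close>. The type below has at least \<open>max |'k| 2^\<aleph>\<^sub>0\<close> elements, because the
  carrier of a field has at least two; hence every two-generated algebra over \<open>K\<close> is isomorphic
  to one carried by a subset of this type, and fixing it loses no generality.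
\<close>

type_synonym ('k, 'a) host = "nat \<Rightarrow> 'k \<times> 'a"

end

theory Submission
  imports Defs
begin

text \<open>
  The operator of \<open>A\<close> extends to the unitization of \<open>A\<close> by annihilating the scalars, and from there
  entrywise to the algebra of column-finite infinite matrices. There two matrices \<open>x\<close> and \<open>y\<close>
  suffice: \<open>x\<close> is the shift, and the first row of \<open>y\<close> lists generators \<open>a\<^sub>n\<close> of \<open>A\<close>. The
  remaining entries of \<open>y\<close> are chosen so that \<open>yxy\<close> is the matrix unit \<open>E\<^sub>0\<^sub>0\<close>; then
  \<open>y x\<^sup>n\<^sup>+\<^sup>3 E\<^sub>0\<^sub>0 = a\<^sub>n E\<^sub>0\<^sub>0\<close>, and \<open>a \<mapsto> a E\<^sub>0\<^sub>0\<close> embeds \<open>A\<close> into the differential algebra generated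
  by \<open>x\<close> and \<open>y\<close>.
\<close>

section \<open>Generalities on differential algebras\<close>

text \<open>The subalgebras, the unitization and the matrix algebra are all checked through this
  rule, which flattens the locale hierarchy to equations over a field and an abelian group.\<close>

lemma lambda_diff_algebraI:
  fixes K (structure) and A (structure)
  assumes "field K" "abelian_group A" "lam \<in> carrier K"
    and "\<And>c x. \<lbrakk>c \<in> carrier K; x \<in> carrier A\<rbrakk> \<Longrightarrow> c \<odot>\<^bsub>A\<^esub> x \<in> carrier A"
    and "\<And>c d x. \<lbrakk>c \<in> carrier K; d \<in> carrier K; x \<in> carrier A\<rbrakk> \<Longrightarrow>
      (c \<oplus>\<^bsub>K\<^esub> d) \<odot>\<^bsub>A\<^esub> x = c \<odot>\<^bsub>A\<^esub> x \<oplus>\<^bsub>A\<^esub> d \<odot>\<^bsub>A\<^esub> x"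
    and "\<And>c x y. \<lbrakk>c \<in> carrier K; x \<in> carrier A; y \<in> carrier A\<rbrakk> \<Longrightarrow>
      c \<odot>\<^bsub>A\<^esub> (x \<oplus>\<^bsub>A\<^esub> y) = c \<odot>\<^bsub>A\<^esub> x \<oplus>\<^bsub>A\<^esub> c \<odot>\<^bsub>A\<^esub> y"
    and "\<And>c d x. \<lbrakk>c \<in> carrier K; d \<in> carrier K; x \<in> carrier A\<rbrakk> \<Longrightarrow>
      (c \<otimes>\<^bsub>K\<^esub> d) \<odot>\<^bsub>A\<^esub> x = c \<odot>\<^bsub>A\<^esub> (d \<odot>\<^bsub>A\<^esub> x)"
    and "\<And>x. x \<in> carrier A \<Longrightarrow> \<one>\<^bsub>K\<^esub> \<odot>\<^bsub>A\<^esub> x = x"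
    and "\<And>x y. \<lbrakk>x \<in> carrier A; y \<in> carrier A\<rbrakk> \<Longrightarrow> x \<otimes>\<^bsub>A\<^esub> y \<in> carrier A"
    and "\<And>x y z. \<lbrakk>x \<in> carrier A; y \<in> carrier A; z \<in> carrier A\<rbrakk> \<Longrightarrow>
      (x \<otimes>\<^bsub>A\<^esub> y) \<otimes>\<^bsub>A\<^esub> z = x \<otimes>\<^bsub>A\<^esub> (y \<otimes>\<^bsub>A\<^esub> z)"
    and "\<And>x y z. \<lbrakk>x \<in> carrier A; y \<in> carrier A; z \<in> carrier A\<rbrakk> \<Longrightarrow>
      (x \<oplus>\<^bsub>A\<^esub> y) \<otimes>\<^bsub>A\<^esub> z = x \<otimes>\<^bsub>A\<^esub> z \<oplus>\<^bsub>A\<^esub> y \<otimes>\<^bsub>A\<^esub> z"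
    and "\<And>x y z. \<lbrakk>x \<in> carrier A; y \<in> carrier A; z \<in> carrier A\<rbrakk> \<Longrightarrow>
      x \<otimes>\<^bsub>A\<^esub> (y \<oplus>\<^bsub>A\<^esub> z) = x \<otimes>\<^bsub>A\<^esub> y \<oplus>\<^bsub>A\<^esub> x \<otimes>\<^bsub>A\<^esub> z"
    and "\<And>c x y. \<lbrakk>c \<in> carrier K; x \<in> carrier A; y \<in> carrier A\<rbrakk> \<Longrightarrow>
      (c \<odot>\<^bsub>A\<^esub> x) \<otimes>\<^bsub>A\<^esub> y = c \<odot>\<^bsub>A\<^esub> (x \<otimes>\<^bsub>A\<^esub> y)"
    and "\<And>c x y. \<lbrakk>c \<in> carrier K; x \<in> carrier A; y \<in> carrier A\<rbrakk> \<Longrightarrow>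
      x \<otimes>\<^bsub>A\<^esub> (c \<odot>\<^bsub>A\<^esub> y) = c \<odot>\<^bsub>A\<^esub> (x \<otimes>\<^bsub>A\<^esub> y)"
    and "\<And>x. x \<in> carrier A \<Longrightarrow> dop A x \<in> carrier A"
    and "\<And>x y. \<lbrakk>x \<in> carrier A; y \<in> carrier A\<rbrakk> \<Longrightarrow>
      dop A (x \<oplus>\<^bsub>A\<^esub> y) = dop A x \<oplus>\<^bsub>A\<^esub> dop A y"
    and "\<And>c x. \<lbrakk>c \<in> carrier K; x \<in> carrier A\<rbrakk> \<Longrightarrow> dop A (c \<odot>\<^bsub>A\<^esub> x) = c \<odot>\<^bsub>A\<^esub> dop A x"
    and "\<And>x y. \<lbrakk>x \<in> carrier A; y \<in> carrier A\<rbrakk> \<Longrightarrow>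
      dop A (x \<otimes>\<^bsub>A\<^esub> y) =
        dop A x \<otimes>\<^bsub>A\<^esub> y \<oplus>\<^bsub>A\<^esub> x \<otimes>\<^bsub>A\<^esub> dop A y \<oplus>\<^bsub>A\<^esub> lam \<odot>\<^bsub>A\<^esub> (dop A x \<otimes>\<^bsub>A\<^esub> dop A y)"
  shows "lambda_diff_algebra K lam A"
proof -
  have "module K A"
    by (rule moduleI) (use assms in \<open>simp_all add: fieldE(1)\<close>)
  then show ?thesis
    by (intro lambda_diff_algebra.intro assoc_algebra.intro assoc_algebra_axioms.intro
        lambda_diff_algebra_axioms.intro) (use assms in simp_all)
qed

context lambda_diff_algebra
begin

lemma uminus_smult:
  assumes "x \<in> carrier A"
  shows "\<ominus>\<^bsub>A\<^esub> x = (\<ominus>\<^bsub>K\<^esub> \<one>\<^bsub>K\<^esub>) \<odot>\<^bsub>A\<^esub> x"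
  using assms smult_l_minus[of "\<one>\<^bsub>K\<^esub>" x] by simp

text \<open>Zero equals the scalar zero times itself, so homogeneity decides its image; the next two
  lemmas use the same device.\<close>

lemma dop_zero [simp]: "dop A \<zero>\<^bsub>A\<^esub> = \<zero>\<^bsub>A\<^esub>"
  using dop_smult[of "\<zero>\<^bsub>K\<^esub>" "\<zero>\<^bsub>A\<^esub>"] dop_closed by simp

lemma mult_zero_left [simp]: "x \<in> carrier A \<Longrightarrow> \<zero>\<^bsub>A\<^esub> \<otimes>\<^bsub>A\<^esub> x = \<zero>\<^bsub>A\<^esub>"
  using mult_smult_left[of "\<zero>\<^bsub>K\<^esub>" "\<zero>\<^bsub>A\<^esub>" x] mult_closed by simp

lemma mult_zero_right [simp]: "x \<in> carrier A \<Longrightarrow> x \<otimes>\<^bsub>A\<^esub> \<zero>\<^bsub>A\<^esub> = \<zero>\<^bsub>A\<^esub>"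
  using mult_smult_right[of "\<zero>\<^bsub>K\<^esub>" x "\<zero>\<^bsub>A\<^esub>"] mult_closed by simp

text \<open>Negation is multiplication by the scalar -1, so closure under scalars covers additive
  inverses. What remains are closure conditions that pass directly to intersections, restrictions
  and preimages.\<close>

lemma diff_subalgebra_iff:
  "diff_subalgebra K A S \<longleftrightarrow>
     S \<subseteq> carrier A \<and> \<zero>\<^bsub>A\<^esub> \<in> S \<and>
     (\<forall>x\<in>S. \<forall>y\<in>S. x \<oplus>\<^bsub>A\<^esub> y \<in> S) \<and> (\<forall>c\<in>carrier K. \<forall>x\<in>S. c \<odot>\<^bsub>A\<^esub> x \<in> S) \<and>
     (\<forall>x\<in>S. \<forall>y\<in>S. x \<otimes>\<^bsub>A\<^esub> y \<in> S) \<and> (\<forall>x\<in>S. dop A x \<in> S)"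
proof -
  have "submodule S K A \<longleftrightarrow> S \<subseteq> carrier A \<and> \<zero>\<^bsub>A\<^esub> \<in> S \<and>
     (\<forall>x\<in>S. \<forall>y\<in>S. x \<oplus>\<^bsub>A\<^esub> y \<in> S) \<and> (\<forall>c\<in>carrier K. \<forall>x\<in>S. c \<odot>\<^bsub>A\<^esub> x \<in> S)" (is "_ \<longleftrightarrow> ?R")
  proof
    assume S: "submodule S K A"
    note E = submoduleE[OF S]
    have "\<zero>\<^bsub>A\<^esub> \<in> S"
      using subgroup.one_closed[OF submodule.axioms(1)[OF S]] by simp
    then show ?R using E by auto
  next
    assume R: ?R
    show "submodule S K A"
    proof (rule submoduleI)
      fix x assume "x \<in> S"
      then show "\<ominus>\<^bsub>A\<^esub> x \<in> S" using R uminus_smult[of x] by auto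
    qed (use R in auto)
  qed
  then show ?thesis unfolding diff_subalgebra_def by blast
qed

lemma diff_subalgebra_carrier: "diff_subalgebra K A (carrier A)"
  by (auto simp: diff_subalgebra_iff mult_closed dop_closed)

text \<open>The axioms are identities inherited from \<open>A\<close>; only closure of
  \<open>S\<close> under the operations is at stake.\<close>

lemma restrict_diff_subalgebra:
  assumes "diff_subalgebra K A S"
  shows "lambda_diff_algebra K lam (A\<lparr>carrier := S\<rparr>)"
proof -
  have S: "S \<subseteq> carrier A" using assms by (simp add: diff_subalgebra_iff)
  have "module K (A\<lparr>carrier := S\<rparr>)"
    using assms by (simp add: diff_subalgebra_def submodule.submodule_is_module module_axioms)
  then interpret S: module K "A\<lparr>carrier := S\<rparr>" .
  have mem [simp]: "x \<in> S \<Longrightarrow> x \<in> carrier A" for x using S by blast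
  show ?thesis
    by (rule lambda_diff_algebraI)
      (use assms in \<open>simp_all add: diff_subalgebra_iff field_axioms S.abelian_group_axioms lam_closed
         smult_l_distr smult_r_distr smult_assoc1 mult_assoc mult_add_left mult_add_right
         mult_smult_left mult_smult_right dop_add dop_smult dop_mult\<close>)
qed

section \<open>Differential subalgebra generated by a set\<close>

definition diff_span :: "'a set \<Rightarrow> 'a set" where
  "diff_span Y = \<Inter>{S. diff_subalgebra K A S \<and> Y \<subseteq> S}"

lemma diff_span_subset: "\<lbrakk>diff_subalgebra K A S; Y \<subseteq> S\<rbrakk> \<Longrightarrow> diff_span Y \<subseteq> S"
  by (auto simp: diff_span_def)

lemma subset_diff_span: "Y \<subseteq> diff_span Y"
  by (auto simp: diff_span_def)

lemma diff_subalgebra_diff_span: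
  assumes "Y \<subseteq> carrier A"
  shows "diff_subalgebra K A (diff_span Y)"
proof -
  \<comment> \<open>The carrier is itself a member of the intersected family and so bounds the
    intersection.\<close>
  have "diff_span Y \<subseteq> carrier A"
    by (rule diff_span_subset[OF diff_subalgebra_carrier assms])
  then show ?thesis
    unfolding diff_subalgebra_iff by (auto simp: diff_span_def diff_subalgebra_iff)
qed

text \<open>Here \<open>generates\<close> ranges over subalgebras of the restricted algebra. These
  are again subalgebras of \<open>A\<close>, so minimality of the span in \<open>A\<close> carries
  over.\<close>

lemma generates_diff_span:
  assumes "Y \<subseteq> carrier A"
  shows "generates K (A\<lparr>carrier := diff_span Y\<rparr>) Y"
proof -
  note sub = diff_subalgebra_diff_span[OF assms]
  interpret H: lambda_diff_algebra K lam "A\<lparr>carrier := diff_span Y\<rparr>"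
    by (rule restrict_diff_subalgebra[OF sub])
  have "diff_subalgebra K A S" if "diff_subalgebra K (A\<lparr>carrier := diff_span Y\<rparr>) S" for S
    using that sub unfolding H.diff_subalgebra_iff diff_subalgebra_iff by auto
  then have "diff_span Y \<subseteq> S"
    if "diff_subalgebra K (A\<lparr>carrier := diff_span Y\<rparr>) S" "Y \<subseteq> S" for S
    using that diff_span_subset by blast
  with H.diff_subalgebra_carrier show ?thesis
    by (auto simp: generates_def subset_diff_span)
qed

lemma diff_hom_compose:
  assumes "f \<in> diff_hom K A B" "g \<in> diff_hom K B C"
  shows "g \<circ> f \<in> diff_hom K A C"
  using assms by (auto simp: diff_hom_def Pi_iff)

text \<open>This reduces the claim that a homomorphism maps all of \<open>A\<close> into a
  subalgebra to a check on generators.\<close>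

lemma diff_subalgebra_vimage:
  assumes B: "lambda_diff_algebra K lam B" and f: "f \<in> diff_hom K A B"
    and S: "diff_subalgebra K B S"
  shows "diff_subalgebra K A {a \<in> carrier A. f a \<in> S}"
proof -
  interpret B: lambda_diff_algebra K lam B by (rule B)
  \<comment> \<open>\<open>diff_hom\<close> does not list preservation of zero; it follows from
    compatibility with scalars.\<close>
  have "f \<zero>\<^bsub>A\<^esub> = f (\<zero>\<^bsub>K\<^esub> \<odot>\<^bsub>A\<^esub> \<zero>\<^bsub>A\<^esub>)" by simp
  also have "\<dots> = \<zero>\<^bsub>K\<^esub> \<odot>\<^bsub>B\<^esub> f \<zero>\<^bsub>A\<^esub>"
    using f unfolding diff_hom_def by blast
  also have "\<dots> = \<zero>\<^bsub>B\<^esub>"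
    using f by (intro B.smult_l_null) (auto simp: diff_hom_def)
  finally show ?thesis
    using S f unfolding B.diff_subalgebra_iff diff_subalgebra_iff
    by (auto simp: diff_hom_def mult_closed dop_closed)
qed

end

section \<open>Unitization\<close>

text \<open>The pair \<open>(c, a)\<close> stands for the formal sum c 1 + a, and the product
  expands (c 1 + a)(d 1 + b). The new unit supplies the entries 1 of the two generating
  matrices.\<close>

definition unitization ::
    "('k, 'r) ring_scheme \<Rightarrow> ('k, 'a, 'm) diff_algebra_scheme \<Rightarrow> ('k, 'k \<times> 'a) diff_algebra" where
  "unitization K A =
    \<lparr>carrier = carrier K \<times> carrier A,
     monoid.mult = \<lambda>(c, a) (d, b). (c \<otimes>\<^bsub>K\<^esub> d, c \<odot>\<^bsub>A\<^esub> b \<oplus>\<^bsub>A\<^esub> d \<odot>\<^bsub>A\<^esub> a \<oplus>\<^bsub>A\<^esub> a \<otimes>\<^bsub>A\<^esub> b),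
     one = (\<one>\<^bsub>K\<^esub>, \<zero>\<^bsub>A\<^esub>),
     ring.zero = (\<zero>\<^bsub>K\<^esub>, \<zero>\<^bsub>A\<^esub>),
     add = \<lambda>(c, a) (d, b). (c \<oplus>\<^bsub>K\<^esub> d, a \<oplus>\<^bsub>A\<^esub> b),
     smult = \<lambda>e (c, a). (e \<otimes>\<^bsub>K\<^esub> c, e \<odot>\<^bsub>A\<^esub> a),
     dop = \<lambda>(c, a). (\<zero>\<^bsub>K\<^esub>, dop A a)\<rparr>"

locale unital_diff_algebra = lambda_diff_algebra K lam A
  for K :: "('k, 'r) ring_scheme" (structure) and lam :: 'k
    and A :: "('k, 'a, 'm) diff_algebra_scheme" (structure) +
  assumes one_closed: "\<one>\<^bsub>A\<^esub> \<in> carrier A"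
    and mult_one_left: "x \<in> carrier A \<Longrightarrow> \<one>\<^bsub>A\<^esub> \<otimes>\<^bsub>A\<^esub> x = x"
    and mult_one_right: "x \<in> carrier A \<Longrightarrow> x \<otimes>\<^bsub>A\<^esub> \<one>\<^bsub>A\<^esub> = x"

context lambda_diff_algebra
begin

lemma unital_diff_algebra_unitization: "unital_diff_algebra K lam (unitization K A)"
proof -
  note K_simps = cring.cring_simprules[OF fieldE(1)[OF field_axioms]]
  have ag: "abelian_group (unitization K A)"
  proof (rule abelian_groupI)
    fix x assume "x \<in> carrier (unitization K A)"
    then show "\<exists>y\<in>carrier (unitization K A).
        y \<oplus>\<^bsub>unitization K A\<^esub> x = \<zero>\<^bsub>unitization K A\<^esub>"
      by (intro bexI[of _ "(\<ominus>\<^bsub>K\<^esub> fst x, \<ominus>\<^bsub>A\<^esub> snd x)"])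
        (auto simp: unitization_def K_simps M.l_neg)
  qed (auto simp: unitization_def K_simps M.a_ac)
  \<comment> \<open>Reversing \<open>smult_assoc1\<close> collapses nested scalars into one product
    in \<open>K\<close>, where commutativity can reorder the factors.\<close>
  note distribs = smult_l_distr smult_r_distr smult_assoc1[symmetric] mult_add_left
    mult_add_right mult_smult_left mult_smult_right mult_closed dop_closed lam_closed
    mult_assoc dop_add dop_smult dop_mult
  have "lambda_diff_algebra K lam (unitization K A)"
    by (rule lambda_diff_algebraI[OF field_axioms ag lam_closed])
      (auto simp: unitization_def distribs K_simps M.a_ac)
  then show ?thesis
    by (intro unital_diff_algebra.intro unital_diff_algebra_axioms.intro)
      (auto simp: unitization_def)
qed

lemma unitization_embedding:
  "(\<lambda>a. (\<zero>\<^bsub>K\<^esub>, a)) \<in> diff_hom K A (unitization K A)"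
  by (auto simp: diff_hom_def unitization_def mult_closed)

end

section \<open>Column-finite matrices\<close>

text \<open>
  Infinite matrices are functions on \<open>nat\<close> via the pairing \<open>prod_encode\<close>, so that matrices
  over the unitization of an algebra live on the type \<open>host\<close>.
\<close>

definition entry :: "(nat \<Rightarrow> 'a) \<Rightarrow> nat \<Rightarrow> nat \<Rightarrow> 'a" where
  "entry h i j = h (prod_encode (i, j))"

definition mat :: "(nat \<Rightarrow> nat \<Rightarrow> 'a) \<Rightarrow> nat \<Rightarrow> 'a" where
  "mat F n = case_prod F (prod_decode n)"

lemma entry_mat [simp]: "entry (mat F) i j = F i j"
  by (simp add: entry_def mat_def)

lemma entry_eqI: "(\<And>i j. entry g i j = entry h i j) \<Longrightarrow> g = h"
  unfolding entry_def by (metis ext prod_decode_inverse surj_pair)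

definition col_supp :: "('k, 'a, 'm) diff_algebra_scheme \<Rightarrow> (nat \<Rightarrow> 'a) \<Rightarrow> nat \<Rightarrow> nat set" where
  "col_supp A h j = {i. entry h i j \<noteq> \<zero>\<^bsub>A\<^esub>}"

lemma col_supp_iff [simp]: "i \<in> col_supp A h j \<longleftrightarrow> entry h i j \<noteq> \<zero>\<^bsub>A\<^esub>"
  by (simp add: col_supp_def)

text \<open>Each entry of a product is a sum over the support of one column of the right factor,
  which is finite. Rows may be infinite, as the first row of \<open>coding\<close> requires.\<close>

definition mat_algebra :: "('k, 'a, 'm) diff_algebra_scheme \<Rightarrow> ('k, nat \<Rightarrow> 'a) diff_algebra" where
  "mat_algebra A =
    \<lparr>carrier = {h. (\<forall>i j. entry h i j \<in> carrier A) \<and> (\<forall>j. finite (col_supp A h j))},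
     monoid.mult = \<lambda>g h. mat (\<lambda>i j. \<Oplus>\<^bsub>A\<^esub>k\<in>col_supp A h j. entry g i k \<otimes>\<^bsub>A\<^esub> entry h k j),
     one = mat (\<lambda>i j. if i = j then \<one>\<^bsub>A\<^esub> else \<zero>\<^bsub>A\<^esub>),
     ring.zero = mat (\<lambda>i j. \<zero>\<^bsub>A\<^esub>),
     add = \<lambda>g h. mat (\<lambda>i j. entry g i j \<oplus>\<^bsub>A\<^esub> entry h i j),
     smult = \<lambda>c h. mat (\<lambda>i j. c \<odot>\<^bsub>A\<^esub> entry h i j),
     dop = \<lambda>h. mat (\<lambda>i j. dop A (entry h i j))\<rparr>"

lemma entry_mat_algebra [simp]:
  "entry \<zero>\<^bsub>mat_algebra A\<^esub> i j = \<zero>\<^bsub>A\<^esub>"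
  "entry (g \<oplus>\<^bsub>mat_algebra A\<^esub> h) i j = entry g i j \<oplus>\<^bsub>A\<^esub> entry h i j"
  "entry (c \<odot>\<^bsub>mat_algebra A\<^esub> h) i j = c \<odot>\<^bsub>A\<^esub> entry h i j"
  "entry (dop (mat_algebra A) h) i j = dop A (entry h i j)"
  by (simp_all add: mat_algebra_def)

lemma entry_mult_support:
  "entry (g \<otimes>\<^bsub>mat_algebra A\<^esub> h) i j
    = (\<Oplus>\<^bsub>A\<^esub>k\<in>col_supp A h j. entry g i k \<otimes>\<^bsub>A\<^esub> entry h k j)"
  by (simp add: mat_algebra_def)

lemma finite_column: "h \<in> carrier (mat_algebra A) \<Longrightarrow> finite (col_supp A h j)"
  by (simp add: mat_algebra_def)

text \<open>Any finite bound on each column support suffices, so exact supports never have to be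
  computed.\<close>

lemma mat_algebra_memI:
  assumes "\<And>i j. entry h i j \<in> carrier A"
    and "\<And>j. finite (S j)" and "\<And>i j. i \<notin> S j \<Longrightarrow> entry h i j = \<zero>\<^bsub>A\<^esub>"
  shows "h \<in> carrier (mat_algebra A)"
proof -
  have "col_supp A h j \<subseteq> S j" for j
    by (metis assms(3) col_supp_iff subsetI)
  then have "finite (col_supp A h j)" for j
    using assms(2) by (rule finite_subset)
  then show ?thesis using assms(1) by (simp add: mat_algebra_def)
qed

lemma entry_closed [simp]: "h \<in> carrier (mat_algebra A) \<Longrightarrow> entry h i j \<in> carrier A"
  by (simp add: mat_algebra_def)

context lambda_diff_algebra
begin

section \<open>Finite sums against the product and the operator\<close>

lemma finsum_mult_left:
  assumes "finite S" "f \<in> S \<rightarrow> carrier A" "b \<in> carrier A"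
  shows "(\<Oplus>\<^bsub>A\<^esub>k\<in>S. f k) \<otimes>\<^bsub>A\<^esub> b = (\<Oplus>\<^bsub>A\<^esub>k\<in>S. f k \<otimes>\<^bsub>A\<^esub> b)"
  using assms by (induction S) (simp_all add: Pi_def mult_closed mult_add_left)

lemma finsum_mult_right:
  assumes "finite S" "f \<in> S \<rightarrow> carrier A" "b \<in> carrier A"
  shows "b \<otimes>\<^bsub>A\<^esub> (\<Oplus>\<^bsub>A\<^esub>k\<in>S. f k) = (\<Oplus>\<^bsub>A\<^esub>k\<in>S. b \<otimes>\<^bsub>A\<^esub> f k)"
  using assms by (induction S) (simp_all add: Pi_def mult_closed mult_add_right)

lemma dop_finsum:
  assumes "finite S" "f \<in> S \<rightarrow> carrier A"
  shows "dop A (\<Oplus>\<^bsub>A\<^esub>k\<in>S. f k) = (\<Oplus>\<^bsub>A\<^esub>k\<in>S. dop A (f k))"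
  using assms by (induction S) (simp_all add: Pi_def dop_closed dop_add)

lemma finsum_swap:
  assumes "finite S" "finite T" "\<And>i k. i \<in> S \<Longrightarrow> k \<in> T \<Longrightarrow> f i k \<in> carrier A"
  shows "(\<Oplus>\<^bsub>A\<^esub>i\<in>S. \<Oplus>\<^bsub>A\<^esub>k\<in>T. f i k) = (\<Oplus>\<^bsub>A\<^esub>k\<in>T. \<Oplus>\<^bsub>A\<^esub>i\<in>S. f i k)"
  using assms
proof (induction S)
  case (insert s S)
  have "(\<Oplus>\<^bsub>A\<^esub>i\<in>insert s S. \<Oplus>\<^bsub>A\<^esub>k\<in>T. f i k)
      = (\<Oplus>\<^bsub>A\<^esub>k\<in>T. f s k) \<oplus>\<^bsub>A\<^esub> (\<Oplus>\<^bsub>A\<^esub>k\<in>T. \<Oplus>\<^bsub>A\<^esub>i\<in>S. f i k)"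
    using insert by (simp add: Pi_def)
  also have "\<dots> = (\<Oplus>\<^bsub>A\<^esub>k\<in>T. f s k \<oplus>\<^bsub>A\<^esub> (\<Oplus>\<^bsub>A\<^esub>i\<in>S. f i k))"
    using insert by (simp add: Pi_def M.finsum_addf)
  also have "\<dots> = (\<Oplus>\<^bsub>A\<^esub>k\<in>T. \<Oplus>\<^bsub>A\<^esub>i\<in>insert s S. f i k)"
    using insert by (intro M.finsum_cong') (simp_all add: Pi_def)
  finally show ?case .
qed simp

section \<open>Supports and products of column-finite matrices\<close>

lemma col_supp_add:
  assumes "g \<in> carrier (mat_algebra A)" "h \<in> carrier (mat_algebra A)"
  shows "col_supp A (g \<oplus>\<^bsub>mat_algebra A\<^esub> h) j \<subseteq> col_supp A g j \<union> col_supp A h j"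
  using assms by (auto simp: col_supp_def)

lemma col_supp_smult: "c \<in> carrier K \<Longrightarrow> col_supp A (c \<odot>\<^bsub>mat_algebra A\<^esub> h) j \<subseteq> col_supp A h j"
  by (auto simp: col_supp_def)

lemma col_supp_dop: "col_supp A (dop (mat_algebra A) h) j \<subseteq> col_supp A h j"
  by (auto simp: col_supp_def)

text \<open>Indices outside the support contribute zero terms. The freedom to enlarge the index set
  lets several products be summed over one common set.\<close>

lemma entry_mult:
  assumes "g \<in> carrier (mat_algebra A)" "h \<in> carrier (mat_algebra A)"
    and "finite S" "col_supp A h j \<subseteq> S"
  shows "entry (g \<otimes>\<^bsub>mat_algebra A\<^esub> h) i j = (\<Oplus>\<^bsub>A\<^esub>k\<in>S. entry g i k \<otimes>\<^bsub>A\<^esub> entry h k j)"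
proof -
  have "(\<Oplus>\<^bsub>A\<^esub>k\<in>col_supp A h j. entry g i k \<otimes>\<^bsub>A\<^esub> entry h k j)
      = (\<Oplus>\<^bsub>A\<^esub>k\<in>S. entry g i k \<otimes>\<^bsub>A\<^esub> entry h k j)"
    by (rule M.add.finprod_mono_neutral_cong_left) (use assms in \<open>auto simp: mult_closed\<close>)
  then show ?thesis by (simp add: entry_mult_support)
qed

text \<open>Column \<open>j\<close> of the product combines only those columns \<open>k\<close> of
  \<open>g\<close> for which \<open>k\<close> lies in the finite support of column \<open>j\<close>
  of \<open>h\<close>.\<close>

lemma mat_mult_closed:
  assumes "g \<in> carrier (mat_algebra A)" "h \<in> carrier (mat_algebra A)"
  shows "g \<otimes>\<^bsub>mat_algebra A\<^esub> h \<in> carrier (mat_algebra A)"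
proof (rule mat_algebra_memI)
  fix i j
  show "entry (g \<otimes>\<^bsub>mat_algebra A\<^esub> h) i j \<in> carrier A"
    using assms by (auto simp: entry_mult_support mult_closed intro!: M.finsum_closed)
next
  fix j
  show "finite (\<Union>k\<in>col_supp A h j. col_supp A g k)"
    using assms by (auto intro: finite_column)
next
  fix i j
  assume "i \<notin> (\<Union>k\<in>col_supp A h j. col_supp A g k)"
  then show "entry (g \<otimes>\<^bsub>mat_algebra A\<^esub> h) i j = \<zero>\<^bsub>A\<^esub>"
    using assms by (auto simp: entry_mult_support intro!: M.add.finprod_one_eqI)
qed

lemma mat_mult_assoc:
  assumes g: "g \<in> carrier (mat_algebra A)" and h: "h \<in> carrier (mat_algebra A)"
    and l: "l \<in> carrier (mat_algebra A)"
  shows "(g \<otimes>\<^bsub>mat_algebra A\<^esub> h) \<otimes>\<^bsub>mat_algebra A\<^esub> l = g \<otimes>\<^bsub>mat_algebra A\<^esub> (h \<otimes>\<^bsub>mat_algebra A\<^esub> l)"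
proof (rule entry_eqI)
  fix i j
  \<comment> \<open>\<open>T\<close> indexes the inner sum against \<open>l\<close>, and
    \<open>S\<close> covers the supports of all columns of \<open>h\<close> with index in
    \<open>T\<close>. Both bracketings become double sums over the same finite rectangle, where the
    order of summation can be exchanged.\<close>
  define T where "T = col_supp A l j"
  define S where "S = (\<Union>m\<in>T. col_supp A h m)"
  have T: "finite T" "col_supp A l j \<subseteq> T"
    using finite_column[OF l] by (auto simp: T_def)
  have S: "finite S" using T(1) finite_column[OF h] by (auto simp: S_def)
  have hS: "col_supp A h m \<subseteq> S" if "m \<in> T" for m
    using that unfolding S_def by blast
  have hl: "entry (h \<otimes>\<^bsub>mat_algebra A\<^esub> l) k j = (\<Oplus>\<^bsub>A\<^esub>m\<in>T. entry h k m \<otimes>\<^bsub>A\<^esub> entry l m j)" for k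
    by (rule entry_mult[OF h l T])
  have "entry (h \<otimes>\<^bsub>mat_algebra A\<^esub> l) k j = \<zero>\<^bsub>A\<^esub>" if "k \<notin> S" for k
    unfolding hl using that l by (intro M.add.finprod_one_eqI) (auto simp: S_def)
  then have hl_supp: "col_supp A (h \<otimes>\<^bsub>mat_algebra A\<^esub> l) j \<subseteq> S"
    by (metis col_supp_iff subsetI)
  have "entry ((g \<otimes>\<^bsub>mat_algebra A\<^esub> h) \<otimes>\<^bsub>mat_algebra A\<^esub> l) i j
      = (\<Oplus>\<^bsub>A\<^esub>m\<in>T. entry (g \<otimes>\<^bsub>mat_algebra A\<^esub> h) i m \<otimes>\<^bsub>A\<^esub> entry l m j)"
    by (rule entry_mult[OF mat_mult_closed[OF g h] l T])
  also have "\<dots> = (\<Oplus>\<^bsub>A\<^esub>m\<in>T. \<Oplus>\<^bsub>A\<^esub>k\<in>S. entry g i k \<otimes>\<^bsub>A\<^esub> (entry h k m \<otimes>\<^bsub>A\<^esub> entry l m j))"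
    using g h l S hS
    by (intro M.finsum_cong')
      (simp_all add: entry_mult[OF g h S] finsum_mult_left mult_closed mult_assoc Pi_def)
  also have "\<dots> = (\<Oplus>\<^bsub>A\<^esub>k\<in>S. \<Oplus>\<^bsub>A\<^esub>m\<in>T. entry g i k \<otimes>\<^bsub>A\<^esub> (entry h k m \<otimes>\<^bsub>A\<^esub> entry l m j))"
    using g h l S T by (intro finsum_swap) (simp_all add: mult_closed)
  also have "\<dots> = (\<Oplus>\<^bsub>A\<^esub>k\<in>S. entry g i k \<otimes>\<^bsub>A\<^esub> entry (h \<otimes>\<^bsub>mat_algebra A\<^esub> l) k j)"
    using g h l T
    by (intro M.finsum_cong') (simp_all add: hl finsum_mult_right mult_closed Pi_def)
  also have "\<dots> = entry (g \<otimes>\<^bsub>mat_algebra A\<^esub> (h \<otimes>\<^bsub>mat_algebra A\<^esub> l)) i j"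
    by (rule entry_mult[OF g mat_mult_closed[OF h l] S hl_supp, symmetric])
  finally show "entry ((g \<otimes>\<^bsub>mat_algebra A\<^esub> h) \<otimes>\<^bsub>mat_algebra A\<^esub> l) i j
      = entry (g \<otimes>\<^bsub>mat_algebra A\<^esub> (h \<otimes>\<^bsub>mat_algebra A\<^esub> l)) i j" .
qed

lemma mat_add_closed:
  assumes "g \<in> carrier (mat_algebra A)" "h \<in> carrier (mat_algebra A)"
  shows "g \<oplus>\<^bsub>mat_algebra A\<^esub> h \<in> carrier (mat_algebra A)"
  by (rule mat_algebra_memI[where S = "\<lambda>j. col_supp A g j \<union> col_supp A h j"])
    (use assms in \<open>auto intro: finite_column\<close>)

lemma mat_smult_closed:
  assumes "c \<in> carrier K" "h \<in> carrier (mat_algebra A)"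
  shows "c \<odot>\<^bsub>mat_algebra A\<^esub> h \<in> carrier (mat_algebra A)"
  by (rule mat_algebra_memI[where S = "\<lambda>j. col_supp A h j"])
    (use assms in \<open>auto intro: finite_column\<close>)

lemma mat_dop_closed:
  assumes "h \<in> carrier (mat_algebra A)"
  shows "dop (mat_algebra A) h \<in> carrier (mat_algebra A)"
  by (rule mat_algebra_memI[where S = "\<lambda>j. col_supp A h j"])
    (use assms in \<open>auto intro: finite_column dop_closed\<close>)

lemma abelian_group_mat_algebra: "abelian_group (mat_algebra A)"
proof (rule abelian_groupI)
  show "\<zero>\<^bsub>mat_algebra A\<^esub> \<in> carrier (mat_algebra A)"
    by (rule mat_algebra_memI[where S = "\<lambda>_. {}"]) auto
next
  fix g assume g: "g \<in> carrier (mat_algebra A)"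
  have "mat (\<lambda>i j. \<ominus>\<^bsub>A\<^esub> entry g i j) \<in> carrier (mat_algebra A)"
    by (rule mat_algebra_memI[where S = "\<lambda>j. col_supp A g j"])
      (use g in \<open>auto intro: finite_column\<close>)
  moreover have "mat (\<lambda>i j. \<ominus>\<^bsub>A\<^esub> entry g i j) \<oplus>\<^bsub>mat_algebra A\<^esub> g = \<zero>\<^bsub>mat_algebra A\<^esub>"
    by (rule entry_eqI) (use g in \<open>simp add: M.l_neg\<close>)
  ultimately show "\<exists>h\<in>carrier (mat_algebra A). h \<oplus>\<^bsub>mat_algebra A\<^esub> g = \<zero>\<^bsub>mat_algebra A\<^esub>"
    by blast
qed (auto simp: M.a_ac mat_add_closed intro!: entry_eqI)

lemma lambda_diff_algebra_mat_algebra: "lambda_diff_algebra K lam (mat_algebra A)"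
proof (rule lambda_diff_algebraI[OF field_axioms abelian_group_mat_algebra lam_closed])
  fix g h l
  assume g: "g \<in> carrier (mat_algebra A)" and h: "h \<in> carrier (mat_algebra A)"
    and l: "l \<in> carrier (mat_algebra A)"
  show "(g \<oplus>\<^bsub>mat_algebra A\<^esub> h) \<otimes>\<^bsub>mat_algebra A\<^esub> l
      = g \<otimes>\<^bsub>mat_algebra A\<^esub> l \<oplus>\<^bsub>mat_algebra A\<^esub> h \<otimes>\<^bsub>mat_algebra A\<^esub> l"
    using g h l
    by (intro entry_eqI)
      (simp add: entry_mult_support mat_add_closed mult_add_left mult_closed M.finsum_addf Pi_def)
  show "g \<otimes>\<^bsub>mat_algebra A\<^esub> (h \<oplus>\<^bsub>mat_algebra A\<^esub> l)
      = g \<otimes>\<^bsub>mat_algebra A\<^esub> h \<oplus>\<^bsub>mat_algebra A\<^esub> g \<otimes>\<^bsub>mat_algebra A\<^esub> l"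
  proof (rule entry_eqI)
    fix i j
    \<comment> \<open>Cancellation can make the support of a sum smaller than the union, so the
      union serves as the common index set.\<close>
    let ?S = "col_supp A h j \<union> col_supp A l j"
    have S: "finite ?S" using finite_column[OF h] finite_column[OF l] by simp
    show "entry (g \<otimes>\<^bsub>mat_algebra A\<^esub> (h \<oplus>\<^bsub>mat_algebra A\<^esub> l)) i j
      = entry (g \<otimes>\<^bsub>mat_algebra A\<^esub> h \<oplus>\<^bsub>mat_algebra A\<^esub> g \<otimes>\<^bsub>mat_algebra A\<^esub> l) i j"
      using g h l
      by (simp add: entry_mult[OF _ _ S] col_supp_add mat_add_closed mult_add_right mult_closed
          M.finsum_addf Pi_def)
  qed
next
  fix g h
  assume g: "g \<in> carrier (mat_algebra A)" and h: "h \<in> carrier (mat_algebra A)"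
  show "dop (mat_algebra A) (g \<otimes>\<^bsub>mat_algebra A\<^esub> h) =
      dop (mat_algebra A) g \<otimes>\<^bsub>mat_algebra A\<^esub> h \<oplus>\<^bsub>mat_algebra A\<^esub>
      g \<otimes>\<^bsub>mat_algebra A\<^esub> dop (mat_algebra A) h \<oplus>\<^bsub>mat_algebra A\<^esub>
      lam \<odot>\<^bsub>mat_algebra A\<^esub> (dop (mat_algebra A) g \<otimes>\<^bsub>mat_algebra A\<^esub> dop (mat_algebra A) h)"
  proof (rule entry_eqI, goal_cases)
    case (1 i j)
    \<comment> \<open>The operator cannot enlarge a support, so all sums run over the support of
      \<open>h\<close> and the Leibniz rule applies term by term.\<close>
    let ?S = "col_supp A h j"
    show ?case
      using g h finite_column[OF h, of j]
      by (simp add: entry_mult[where S = ?S] col_supp_dop mat_dop_closed dop_finsum dop_mult dop_closed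
          mult_closed lam_closed finsum_smult_ldistr M.finsum_addf Pi_def)
  qed
next
  fix c g h
  assume c: "c \<in> carrier K"
    and g: "g \<in> carrier (mat_algebra A)" and h: "h \<in> carrier (mat_algebra A)"
  have S: "finite (col_supp A h j)" for j by (rule finite_column[OF h])
  show "(c \<odot>\<^bsub>mat_algebra A\<^esub> g) \<otimes>\<^bsub>mat_algebra A\<^esub> h = c \<odot>\<^bsub>mat_algebra A\<^esub> (g \<otimes>\<^bsub>mat_algebra A\<^esub> h)"
    using c g h
    by (intro entry_eqI)
      (simp add: entry_mult_support mat_smult_closed mult_smult_left mult_closed
        finsum_smult_ldistr S Pi_def)
  show "g \<otimes>\<^bsub>mat_algebra A\<^esub> (c \<odot>\<^bsub>mat_algebra A\<^esub> h) = c \<odot>\<^bsub>mat_algebra A\<^esub> (g \<otimes>\<^bsub>mat_algebra A\<^esub> h)"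
  proof (rule entry_eqI, goal_cases)
    case (1 i j)
    \<comment> \<open>A zero scalar empties the support, so the support of \<open>h\<close> is the
      index set on both sides.\<close>
    show ?case
      using c g h
      by (simp add: entry_mult[OF _ _ S[of j]] col_supp_smult mat_smult_closed mult_smult_right mult_closed
          finsum_smult_ldistr S Pi_def)
  qed
qed (auto simp: mat_mult_closed mat_mult_assoc mat_smult_closed mat_dop_closed
    smult_l_distr smult_r_distr smult_assoc1 dop_add dop_smult intro!: entry_eqI)

end

section \<open>Monomial matrices and the two generators\<close>

text \<open>On columns this is the map sending e_j to c_j e_(p j). Having at most one nonzero entry
  per column makes it column-finite.\<close>

definition monomial ::
    "('k, 'a, 'm) diff_algebra_scheme \<Rightarrow> (nat \<Rightarrow> nat) \<Rightarrow> (nat \<Rightarrow> 'a) \<Rightarrow> nat \<Rightarrow> 'a" where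
  "monomial A p c = mat (\<lambda>i j. if i = p j then c j else \<zero>\<^bsub>A\<^esub>)"

text \<open>This is \<open>a\<close> times the matrix unit E_00, in monomial form so that
  \<open>monomial_mult\<close> applies.\<close>

definition corner :: "('k, 'a, 'm) diff_algebra_scheme \<Rightarrow> 'a \<Rightarrow> nat \<Rightarrow> 'a" where
  "corner A a = monomial A (\<lambda>_. 0) (\<lambda>j. if j = 0 then a else \<zero>\<^bsub>A\<^esub>)"

definition shift :: "('k, 'a, 'm) diff_algebra_scheme \<Rightarrow> nat \<Rightarrow> 'a" where
  "shift A = monomial A Suc (\<lambda>_. \<one>\<^bsub>A\<^esub>)"

text \<open>Columns 0, 1 and 2 are reserved for producing E_00 from the two generators; the sequence
  starts at column 3, hence \<open>j - 3\<close>.\<close>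

definition coding :: "('k, 'a, 'm) diff_algebra_scheme \<Rightarrow> (nat \<Rightarrow> 'a) \<Rightarrow> nat \<Rightarrow> 'a" where
  "coding A a = monomial A (\<lambda>j. if j = 0 then 1 else 0)
     (\<lambda>j. if j = 0 \<or> j = 2 then \<one>\<^bsub>A\<^esub> else if j = 1 then \<zero>\<^bsub>A\<^esub> else a (j - 3))"

lemma entry_monomial [simp]: "entry (monomial A p c) i j = (if i = p j then c j else \<zero>\<^bsub>A\<^esub>)"
  by (simp add: monomial_def)

lemma inj_corner: "inj (corner A)"
proof (rule injI)
  fix a b assume "corner A a = corner A b"
  then have "entry (corner A a) 0 0 = entry (corner A b) 0 0" by simp
  then show "a = b" by (simp add: corner_def)
qed

context lambda_diff_algebra
begin

lemma monomial_closed: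
  assumes "\<And>j. c j \<in> carrier A"
  shows "monomial A p c \<in> carrier (mat_algebra A)"
  by (rule mat_algebra_memI[where S = "\<lambda>j. {p j}"]) (use assms in auto)

text \<open>Column \<open>j\<close> of the right factor is supported in \<open>{q j}\<close>, so
  each entry sum has a single term. Matrix computations reduce to composing index maps.\<close>

lemma monomial_mult:
  assumes "\<And>j. c j \<in> carrier A" "\<And>j. d j \<in> carrier A"
  shows "monomial A p c \<otimes>\<^bsub>mat_algebra A\<^esub> monomial A q d
    = monomial A (p \<circ> q) (\<lambda>j. c (q j) \<otimes>\<^bsub>A\<^esub> d j)"
proof (rule entry_eqI)
  fix i j
  have "entry (monomial A p c \<otimes>\<^bsub>mat_algebra A\<^esub> monomial A q d) i j
      = (\<Oplus>\<^bsub>A\<^esub>k\<in>{q j}. entry (monomial A p c) i k \<otimes>\<^bsub>A\<^esub> entry (monomial A q d) k j)"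
    by (rule entry_mult) (use assms in \<open>auto simp: monomial_closed col_supp_def\<close>)
  then show "entry (monomial A p c \<otimes>\<^bsub>mat_algebra A\<^esub> monomial A q d) i j
      = entry (monomial A (p \<circ> q) (\<lambda>j. c (q j) \<otimes>\<^bsub>A\<^esub> d j)) i j"
    using assms by (simp add: mult_closed)
qed

text \<open>Only the entries at (0,0) meet in a product of corner matrices, and the operator acts
  entrywise and fixes zero.\<close>

lemma corner_diff_hom: "corner A \<in> diff_hom K A (mat_algebra A)"
  by (auto simp: diff_hom_def corner_def monomial_mult mult_closed intro!: monomial_closed entry_eqI)

end

context unital_diff_algebra
begin

lemma shift_closed: "shift A \<in> carrier (mat_algebra A)"
  unfolding shift_def by (rule monomial_closed) (rule one_closed)

lemma coding_closed: "(\<And>n. a n \<in> carrier A) \<Longrightarrow> coding A a \<in> carrier (mat_algebra A)"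
  unfolding coding_def by (rule monomial_closed) (simp add: one_closed)

text \<open>
  On columns, \<open>x = shift A\<close> maps \<open>e\<^sub>j\<close> to \<open>e\<^sub>j\<^sub>+\<^sub>1\<close>, while \<open>y = coding A a\<close> maps
  \<open>e\<^sub>0 \<mapsto> e\<^sub>1\<close>, \<open>e\<^sub>1 \<mapsto> 0\<close>, \<open>e\<^sub>2 \<mapsto> e\<^sub>0\<close> and \<open>e\<^sub>n\<^sub>+\<^sub>3 \<mapsto> a\<^sub>n e\<^sub>0\<close>. Hence \<open>yxy\<close> fixes \<open>e\<^sub>0\<close> and kills every
  other \<open>e\<^sub>j\<close>, because \<open>y\<close> sends those into the line of \<open>e\<^sub>0\<close> and \<open>yx e\<^sub>0 = y e\<^sub>1 = 0\<close>.
\<close>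

lemma coding_shift_coding:
  assumes "\<And>n. a n \<in> carrier A"
  shows "coding A a \<otimes>\<^bsub>mat_algebra A\<^esub> (shift A \<otimes>\<^bsub>mat_algebra A\<^esub> coding A a) = corner A \<one>\<^bsub>A\<^esub>"
  using assms unfolding coding_def shift_def corner_def
  by (intro entry_eqI) (simp add: monomial_mult one_closed mult_closed mult_one_left)

text \<open>Left multiplication by \<open>shift A\<close> moves the unit of E_00 down column 0;
  \<open>coding A a\<close> then returns it to the corner with a coefficient selected by the row it
  has reached.\<close>

lemma corner_mem_diff_subalgebra:
  assumes a: "\<And>n. a n \<in> carrier A"
    and S: "diff_subalgebra K (mat_algebra A) S" "shift A \<in> S" "coding A a \<in> S"
  shows "corner A (a n) \<in> S"
proof -
  \<comment> \<open>\<open>?e m\<close> is the matrix unit E_m0, obtained from E_00 by m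
    shifts.\<close>
  let ?e = "\<lambda>n. monomial A (\<lambda>_. n) (\<lambda>j. if j = 0 then \<one>\<^bsub>A\<^esub> else \<zero>\<^bsub>A\<^esub>)"
  have mult: "g \<otimes>\<^bsub>mat_algebra A\<^esub> h \<in> S" if "g \<in> S" "h \<in> S" for g h
    using S(1) that by (auto simp: diff_subalgebra_def)
  have e: "?e m \<in> S" for m
  proof (induction m)
    case 0
    have "coding A a \<otimes>\<^bsub>mat_algebra A\<^esub> (shift A \<otimes>\<^bsub>mat_algebra A\<^esub> coding A a) \<in> S"
      using S by (intro mult)
    then show ?case using a by (simp add: coding_shift_coding corner_def)
  next
    case (Suc m)
    have "shift A \<otimes>\<^bsub>mat_algebra A\<^esub> ?e m = ?e (Suc m)"
      unfolding shift_def
      by (intro entry_eqI) (simp add: monomial_mult one_closed mult_one_left)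
    then show ?case using mult[OF S(2) Suc] by simp
  qed
  \<comment> \<open>Row \<open>n + 3\<close> is the one to reach, because column
    \<open>n + 3\<close> of \<open>coding A a\<close> carries \<open>a n\<close>.\<close>
  have "coding A a \<otimes>\<^bsub>mat_algebra A\<^esub> ?e (n + 3) = corner A (a n)"
    using a unfolding coding_def corner_def
    by (intro entry_eqI) (simp add: monomial_mult one_closed mult_one_right)
  then show ?thesis using mult[OF S(3) e, of "n + 3"] by simp
qed

end

section \<open>The embedding theorem\<close>

theorem theorem7p3:
  fixes K :: "('k, 'r) ring_scheme" and lam :: 'k and A :: "('k, 'a) diff_algebra"
  assumes "field K" and "lam \<in> carrier K"
    and "lambda_diff_algebra K lam A" and "countably_generated K A"
  shows "\<exists>H :: ('k, ('k, 'a) host) diff_algebra.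
           lambda_diff_algebra K lam H \<and> two_generated K H \<and>
           (\<exists>f. f \<in> diff_hom K A H \<and> inj_on f (carrier A))"
proof -
  interpret A: lambda_diff_algebra K lam A by (rule assms(3))
  define U where "U = unitization K A"
  interpret U: unital_diff_algebra K lam U
    unfolding U_def by (rule A.unital_diff_algebra_unitization)
  define B where "B = mat_algebra U"
  interpret B: lambda_diff_algebra K lam B
    unfolding B_def by (rule U.lambda_diff_algebra_mat_algebra)

  obtain Y where Y: "countable Y" "generates K A Y"
    using assms(4) by (auto simp: countably_generated_def)
  \<comment> \<open>\<open>from_nat_into\<close> enumerates only nonempty sets; adding zero covers
    an empty \<open>Y\<close> and stays inside the carrier. A finite set is enumerated with
    repetitions.\<close>
  define a where "a = from_nat_into (insert \<zero>\<^bsub>A\<^esub> Y)"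
  have range_a: "range a = insert \<zero>\<^bsub>A\<^esub> Y"
    unfolding a_def using Y(1) by (intro range_from_nat_into) auto
  moreover have "Y \<subseteq> carrier A" using Y(2) by (simp add: generates_def)
  ultimately have a_closed: "a n \<in> carrier A" for n
    by (metis A.M.zero_closed insert_iff rangeI subset_iff)

  define i where "i = (\<lambda>x. (\<zero>\<^bsub>K\<^esub>, x :: 'a))"
  have i: "i \<in> diff_hom K A U"
    unfolding i_def U_def by (rule A.unitization_embedding)
  then have ia_closed: "i (a n) \<in> carrier U" for n
    using a_closed by (auto simp: diff_hom_def)
  define f where "f = corner U \<circ> i"
  have f: "f \<in> diff_hom K A B"
    unfolding f_def B_def by (rule A.diff_hom_compose[OF i U.corner_diff_hom])
  have inj_f: "inj f"
    unfolding f_def by (intro inj_compose inj_corner) (simp add: i_def inj_def)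

  define x y where "x = shift U" and "y = coding U (\<lambda>n. i (a n))"
  have xy: "{x, y} \<subseteq> carrier B"
    using U.shift_closed U.coding_closed[OF ia_closed] by (simp add: x_def y_def B_def)
  \<comment> \<open>Cutting \<open>B\<close> down to the span makes \<open>x\<close> and
    \<open>y\<close> generators; what remains is that \<open>f\<close> takes its values
    there.\<close>
  define H where "H = B\<lparr>carrier := B.diff_span {x, y}\<rparr>"
  note sub = B.diff_subalgebra_diff_span[OF xy]
  have "x \<in> B.diff_span {x, y}" "y \<in> B.diff_span {x, y}"
    using B.subset_diff_span[of "{x, y}"] by simp_all
  then have fa: "f (a n) \<in> B.diff_span {x, y}" for n
    using U.corner_mem_diff_subalgebra[where a = "\<lambda>n. i (a n)", OF ia_closed sub[unfolded B_def]]
    by (simp add: f_def x_def y_def B_def)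
  have "Y \<subseteq> {z \<in> carrier A. f z \<in> B.diff_span {x, y}}"
  proof
    fix z assume "z \<in> Y"
    then have "z \<in> range a" by (simp add: range_a)
    then show "z \<in> {z \<in> carrier A. f z \<in> B.diff_span {x, y}}"
      using a_closed fa by auto
  qed
  \<comment> \<open>The preimage of the span under \<open>f\<close> is a differential subalgebra
    containing the generating set \<open>Y\<close>, hence all of \<open>A\<close>.\<close>
  then have "carrier A \<subseteq> {z \<in> carrier A. f z \<in> B.diff_span {x, y}}"
    using Y(2) A.diff_subalgebra_vimage[OF B.lambda_diff_algebra_axioms f sub]
    by (auto simp: generates_def)
  then have "f \<in> diff_hom K A H"
    using f by (auto simp: diff_hom_def H_def)
  moreover have "lambda_diff_algebra K lam H"
    unfolding H_def by (rule B.restrict_diff_subalgebra[OF sub])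
  moreover have "two_generated K H"
    unfolding two_generated_def H_def using B.generates_diff_span[OF xy] by blast
  ultimately show ?thesis
    using inj_f by (auto intro: inj_on_subset)
qed

end
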